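(* Let $\theta\in\mathbb{R}\setminus\mathbb{Q}$, let $(m,n)\in\mathbb{Z}^2$, and let $w=\lambda U^mV^n$ with $\lambda\in\mathbb{C}$, $|\lambda|=1$. Suppose that $v\in A_\theta^\infty$ is a harmonic unitary. Then $\operatorname{Ad}w(v)=wvw^*$ is also a harmonic unitary.
   Context: For irrational $\theta$, $A_\theta$ is the universal $C^*$-algebra generated by two unitaries $U,V$ with $UV=e^{2\pi i\theta}VU$, and $A_\theta^\infty$ is the smooth dense subalgebra (elements $\sum a_{m,n}U^mV^n$ with rapidly decreasing coefficients). $\delta_1,\delta_2$ are the $*$-derivations of $A_\theta^\infty$ determined by $\delta_1(U)=2\pi iU$, $\delta_1(V)=0$, $\delta_2(U)=0$, $\delta_2(V)=2\pi iV$, and $\Delta=\delta_1^2+\delta_2^2$. A unitary $W\in A_\theta^\infty$ is harmonic if $\sum_{j=1}^2\delta_j\big(W^*\delta_j(W)\big)=W^*(\Delta W)+\delta_1(W)^*\delta_1(W)+\delta_2(W)^*\delta_2(W)=0$. $\operatorname{Ad}w$ is the inner automorphism $a\mapsto waw^*$. *)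

theory Defs
  imports "HOL-Analysis.Analysis" "HOL-Algebra.Algebra" "HOL-Algebra.Algebraic_Closure_Type"
begin

section \<open>Unital \<open>C\<^sup>*\<close>-algebras\<close>

record 'a cstar = "(complex, 'a) module" +
  adj :: "'a \<Rightarrow> 'a"
  cnorm :: "'a \<Rightarrow> real"

abbreviation complex_ring :: "complex ring" where
  "complex_ring \<equiv> ring_of_type_algebra"

text \<open>The locale \<open>Metric_space\<close> wants a function that is symmetric and nonnegative on the whole
  type, hence the value 0 off the carrier.\<close>

definition cdist :: "('a, 'm) cstar_scheme \<Rightarrow> 'a \<Rightarrow> 'a \<Rightarrow> real" where
  "cdist A x y = (if x \<in> carrier A \<and> y \<in> carrier A then cnorm A (x \<ominus>\<^bsub>A\<^esub> y) else 0)"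

definition norm_topology :: "('a, 'm) cstar_scheme \<Rightarrow> 'a topology" where
  "norm_topology A = Metric_space.mtopology (carrier A) (cdist A)"

locale unital_cstar_algebra =
  module complex_ring A + ring A for A :: "('a, 'm) cstar_scheme" (structure) +
  assumes smult_mult_left: "\<lbrakk>x \<in> carrier A; y \<in> carrier A\<rbrakk> \<Longrightarrow> (c \<odot> x) \<otimes> y = c \<odot> (x \<otimes> y)"
    and smult_mult_right: "\<lbrakk>x \<in> carrier A; y \<in> carrier A\<rbrakk> \<Longrightarrow> x \<otimes> (c \<odot> y) = c \<odot> (x \<otimes> y)"
    and adj_closed: "x \<in> carrier A \<Longrightarrow> adj A x \<in> carrier A"
    and adj_adj: "x \<in> carrier A \<Longrightarrow> adj A (adj A x) = x"
    and adj_add: "\<lbrakk>x \<in> carrier A; y \<in> carrier A\<rbrakk> \<Longrightarrow> adj A (x \<oplus> y) = adj A x \<oplus> adj A y"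
    and adj_smult: "x \<in> carrier A \<Longrightarrow> adj A (c \<odot> x) = cnj c \<odot> adj A x"
    and adj_mult: "\<lbrakk>x \<in> carrier A; y \<in> carrier A\<rbrakk> \<Longrightarrow> adj A (x \<otimes> y) = adj A y \<otimes> adj A x"
    and cnorm_nonneg: "x \<in> carrier A \<Longrightarrow> 0 \<le> cnorm A x"
    and cnorm_eq_zero: "x \<in> carrier A \<Longrightarrow> cnorm A x = 0 \<longleftrightarrow> x = \<zero>"
    and cnorm_triangle:
      "\<lbrakk>x \<in> carrier A; y \<in> carrier A\<rbrakk> \<Longrightarrow> cnorm A (x \<oplus> y) \<le> cnorm A x + cnorm A y"
    and cnorm_smult: "x \<in> carrier A \<Longrightarrow> cnorm A (c \<odot> x) = cmod c * cnorm A x"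
    and cnorm_mult:
      "\<lbrakk>x \<in> carrier A; y \<in> carrier A\<rbrakk> \<Longrightarrow> cnorm A (x \<otimes> y) \<le> cnorm A x * cnorm A y"
    and cstar_identity: "x \<in> carrier A \<Longrightarrow> cnorm A (adj A x \<otimes> x) = (cnorm A x)\<^sup>2"
    and complete: "Metric_space.mcomplete (carrier A) (cdist A)"

lemma (in unital_cstar_algebra) Metric_space_cdist: "Metric_space (carrier A) (cdist A)"
proof
  have neg: "cnorm A (\<ominus> x) = cnorm A x" if "x \<in> carrier A" for x
  proof -
    have "(-1) \<odot> x \<in> carrier A"
      using smult_closed[of "-1" x] that by (simp add: ring_of_type_algebra_def)
    moreover have "(-1) \<odot> x \<oplus> x = \<zero>"
      using smult_l_distr[of "-1" 1 x] smult_one[OF that] smult_l_null[OF that] that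
      by (simp add: ring_of_type_algebra_def)
    ultimately have "\<ominus> x = (-1) \<odot> x"
      using that by (intro M.minus_equality)
    then show ?thesis
      using cnorm_smult[OF that, of "-1"] by simp
  qed
  fix x y z
  show "0 \<le> cdist A x y" by (auto simp: cdist_def cnorm_nonneg)
  show "cdist A x y = cdist A y x"
    using neg[of "x \<ominus> y"] by (auto simp: cdist_def minus_eq minus_add a_comm)
  assume x: "x \<in> carrier A" "y \<in> carrier A"
  thus "cdist A x y = 0 \<longleftrightarrow> x = y" by (auto simp: cdist_def cnorm_eq_zero r_right_minus_eq)
  assume "z \<in> carrier A"
  moreover have "x \<ominus> z = (x \<ominus> y) \<oplus> (y \<ominus> z)" if "z \<in> carrier A"
    using x that by (simp add: minus_eq a_assoc r_neg1)
  ultimately show "cdist A x z \<le> cdist A x y + cdist A y z"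
    using x cnorm_triangle[of "x \<ominus> y" "y \<ominus> z"] by (simp add: cdist_def)
qed

definition unitary :: "('a, 'm) cstar_scheme \<Rightarrow> 'a \<Rightarrow> bool" where
  "unitary A u \<longleftrightarrow> u \<in> carrier A \<and>
     adj A u \<otimes>\<^bsub>A\<^esub> u = \<one>\<^bsub>A\<^esub> \<and> u \<otimes>\<^bsub>A\<^esub> adj A u = \<one>\<^bsub>A\<^esub>"

definition Ad :: "('a, 'm) cstar_scheme \<Rightarrow> 'a \<Rightarrow> 'a \<Rightarrow> 'a" where
  "Ad A w a = w \<otimes>\<^bsub>A\<^esub> a \<otimes>\<^bsub>A\<^esub> adj A w"

definition star_hom ::
  "('a, 'm) cstar_scheme \<Rightarrow> ('b, 'n) cstar_scheme \<Rightarrow> ('a \<Rightarrow> 'b) \<Rightarrow> bool" where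
  "star_hom A B \<phi> \<longleftrightarrow> \<phi> \<in> ring_hom A B \<and>
     (\<forall>c. \<forall>x\<in>carrier A. \<phi> (c \<odot>\<^bsub>A\<^esub> x) = c \<odot>\<^bsub>B\<^esub> \<phi> x) \<and>
     (\<forall>x\<in>carrier A. \<phi> (adj A x) = adj B (\<phi> x))"

definition closed_star_subalgebra :: "('a, 'm) cstar_scheme \<Rightarrow> 'a set \<Rightarrow> bool" where
  "closed_star_subalgebra A S \<longleftrightarrow> subring S A \<and>
     (\<forall>c. \<forall>x\<in>S. c \<odot>\<^bsub>A\<^esub> x \<in> S) \<and> (\<forall>x\<in>S. adj A x \<in> S) \<and> closedin (norm_topology A) S"


section \<open>The rotation algebra and its smooth subalgebra\<close>

definition rotation_pair :: "real \<Rightarrow> ('a, 'm) cstar_scheme \<Rightarrow> 'a \<Rightarrow> 'a \<Rightarrow> bool" where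
  "rotation_pair \<theta> A U V \<longleftrightarrow> unitary A U \<and> unitary A V \<and>
     U \<otimes>\<^bsub>A\<^esub> V = exp (2 * of_real pi * \<i> * of_real \<theta>) \<odot>\<^bsub>A\<^esub> (V \<otimes>\<^bsub>A\<^esub> U)"

text \<open>
  The universal \<open>C\<^sup>*\<close>-algebra generated by two unitaries satisfying the relation.  The test algebras
  \<open>B\<close> range over those whose carrier is a set of reals, since a formula cannot quantify over types.
  This is the full universal property: a homomorphism with prescribed values at \<open>U\<close> and \<open>V\<close> takes its
  values in the \<open>C\<^sup>*\<close>-subalgebra that \<open>u\<close> and \<open>v\<close> generate in the target, this subalgebra is
  separable, so it has at most continuum many elements and is isomorphic to one carried by a set of
  reals.  Uniqueness of \<open>\<phi>\<close> on the carrier follows from generation.  The \<open>*\<close>-homomorphisms are unital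
  because \<open>\<one> = U\<^sup>* U\<close> is sent to \<open>u\<^sup>* u = \<one>\<close>.
\<close>

definition rotation_algebra :: "real \<Rightarrow> ('a, 'm) cstar_scheme \<Rightarrow> 'a \<Rightarrow> 'a \<Rightarrow> bool" where
  "rotation_algebra \<theta> A U V \<longleftrightarrow>
     unital_cstar_algebra A \<and> rotation_pair \<theta> A U V \<and>
     (\<forall>S. closed_star_subalgebra A S \<and> U \<in> S \<and> V \<in> S \<longrightarrow> S = carrier A) \<and>
     (\<forall>(B :: real cstar) u v. unital_cstar_algebra B \<and> rotation_pair \<theta> B u v \<longrightarrow>
        (\<exists>\<phi>. star_hom A B \<phi> \<and> \<phi> U = u \<and> \<phi> V = v))"

definition rapidly_decreasing :: "(int \<times> int \<Rightarrow> complex) \<Rightarrow> bool" where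
  "rapidly_decreasing a \<longleftrightarrow>
     (\<forall>k::nat. \<exists>C. \<forall>m n. (1 + \<bar>real_of_int m\<bar> + \<bar>real_of_int n\<bar>) ^ k * cmod (a (m, n)) \<le> C)"

text \<open>The double series is the unordered sum, i.e. the norm limit of the net of finite partial sums.\<close>

definition smooth_subalgebra :: "('a, 'm) cstar_scheme \<Rightarrow> 'a \<Rightarrow> 'a \<Rightarrow> 'a set" where
  "smooth_subalgebra A U V = {x \<in> carrier A. \<exists>a. rapidly_decreasing a \<and>
     limitin (norm_topology A)
       (\<lambda>F. \<Oplus>\<^bsub>A\<^esub>p\<in>F. a p \<odot>\<^bsub>A\<^esub> (U [^]\<^bsub>A\<^esub> fst p \<otimes>\<^bsub>A\<^esub> V [^]\<^bsub>A\<^esub> snd p))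
       x (finite_subsets_at_top UNIV)}"


section \<open>Derivations and harmonic unitaries\<close>

definition star_derivation :: "('a, 'm) cstar_scheme \<Rightarrow> 'a set \<Rightarrow> ('a \<Rightarrow> 'a) \<Rightarrow> bool" where
  "star_derivation A D \<delta> \<longleftrightarrow> \<delta> \<in> D \<rightarrow> D \<and>
     (\<forall>x\<in>D. \<forall>y\<in>D. \<delta> (x \<oplus>\<^bsub>A\<^esub> y) = \<delta> x \<oplus>\<^bsub>A\<^esub> \<delta> y) \<and>
     (\<forall>c. \<forall>x\<in>D. \<delta> (c \<odot>\<^bsub>A\<^esub> x) = c \<odot>\<^bsub>A\<^esub> \<delta> x) \<and>
     (\<forall>x\<in>D. \<forall>y\<in>D. \<delta> (x \<otimes>\<^bsub>A\<^esub> y) = \<delta> x \<otimes>\<^bsub>A\<^esub> y \<oplus>\<^bsub>A\<^esub> x \<otimes>\<^bsub>A\<^esub> \<delta> y) \<and>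
     (\<forall>x\<in>D. \<delta> (adj A x) = adj A (\<delta> x))"

definition canonical_derivations ::
  "('a, 'm) cstar_scheme \<Rightarrow> 'a \<Rightarrow> 'a \<Rightarrow> ('a \<Rightarrow> 'a) \<Rightarrow> ('a \<Rightarrow> 'a) \<Rightarrow> bool" where
  "canonical_derivations A U V \<delta>\<^sub>1 \<delta>\<^sub>2 \<longleftrightarrow>
     star_derivation A (smooth_subalgebra A U V) \<delta>\<^sub>1 \<and>
     star_derivation A (smooth_subalgebra A U V) \<delta>\<^sub>2 \<and>
     \<delta>\<^sub>1 U = (2 * of_real pi * \<i>) \<odot>\<^bsub>A\<^esub> U \<and> \<delta>\<^sub>1 V = \<zero>\<^bsub>A\<^esub> \<and>
     \<delta>\<^sub>2 U = \<zero>\<^bsub>A\<^esub> \<and> \<delta>\<^sub>2 V = (2 * of_real pi * \<i>) \<odot>\<^bsub>A\<^esub> V"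

definition harmonic_unitary ::
  "('a, 'm) cstar_scheme \<Rightarrow> 'a \<Rightarrow> 'a \<Rightarrow> ('a \<Rightarrow> 'a) \<Rightarrow> ('a \<Rightarrow> 'a) \<Rightarrow> 'a \<Rightarrow> bool" where
  "harmonic_unitary A U V \<delta>\<^sub>1 \<delta>\<^sub>2 W \<longleftrightarrow>
     W \<in> smooth_subalgebra A U V \<and> unitary A W \<and>
     \<delta>\<^sub>1 (adj A W \<otimes>\<^bsub>A\<^esub> \<delta>\<^sub>1 W) \<oplus>\<^bsub>A\<^esub> \<delta>\<^sub>2 (adj A W \<otimes>\<^bsub>A\<^esub> \<delta>\<^sub>2 W) = \<zero>\<^bsub>A\<^esub>"

end

theory Submission
  imports Defs
begin

text \<open>
  Each of the derivations \<open>\<delta>\<^sub>1\<close>, \<open>\<delta>\<^sub>2\<close> has \<open>U\<close> and \<open>V\<close> as eigenvectors with purely imaginary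
  eigenvalue, hence so is \<open>w = c U\<^sup>m V\<^sup>n\<close>, and \<open>w\<^sup>*\<close> has the opposite eigenvalue.  By the Leibniz rule
  these two eigenvalues cancel in \<open>\<delta> (w x w\<^sup>*)\<close>, so \<open>\<delta>\<close> commutes with \<open>Ad w\<close> (\<open>derivation_Ad\<close>).
  Since \<open>Ad w\<close> is also a \<open>*\<close>-automorphism, the harmonic expression of \<open>Ad w v\<close> is \<open>Ad w\<close>
  applied to that of \<open>v\<close>, hence zero (\<open>derivation_energy_Ad\<close>).

  The Leibniz rule is available only on the smooth elements, so the argument rests on the fact that
  these form a \<open>*\<close>-algebra containing the monomials: the elements \<open>w x\<close>, \<open>w x w\<^sup>*\<close> and
  \<open>v\<^sup>* \<delta> v\<close> must all be smooth.  This is where the analysis lies.  Monomials multiply up to a phase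
  (\<open>monomial_mult\<close>), so the product of two Fourier series should have as coefficients a convolution
  twisted by phases.  Rapid decrease of this convolution follows from the submultiplicativity of the
  weight \<open>1 + \<bar>m\<bar> + \<bar>n\<bar>\<close> (\<open>rapidly_decreasing_twisted_convolution\<close>), and convergence to the product
  from an \<open>\<ell>\<^sup>1\<close> estimate of the difference between the partial sums of the convolution and the
  product of partial sums (\<open>fourier_series_mult\<close>).
\<close>

section \<open>Unitaries in a unital \<open>C\<^sup>*\<close>-algebra\<close>

context unital_cstar_algebra
begin

lemma scalar_closed [simp, intro]: "x \<in> carrier A \<Longrightarrow> c \<odot> x \<in> carrier A"
  using smult_closed[of c x] by (simp add: ring_of_type_algebra_def)

lemma scalar_scalar: "x \<in> carrier A \<Longrightarrow> c \<odot> (d \<odot> x) = (c * d) \<odot> x"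
  using smult_assoc1[of c d x] by (simp add: ring_of_type_algebra_def)

lemma scalar_add: "x \<in> carrier A \<Longrightarrow> (c + d) \<odot> x = c \<odot> x \<oplus> d \<odot> x"
  using smult_l_distr[of c d x] by (simp add: ring_of_type_algebra_def)

lemma scalar_one [simp]: "x \<in> carrier A \<Longrightarrow> 1 \<odot> x = x"
  using smult_one[of x] by (simp add: ring_of_type_algebra_def)

lemma scalar_zero [simp]: "x \<in> carrier A \<Longrightarrow> 0 \<odot> x = \<zero>"
  using smult_l_null[of x] by (simp add: ring_of_type_algebra_def)

lemma scalar_zero_right [simp]: "c \<odot> \<zero> = \<zero>"
  using smult_r_null[of c] by (simp add: ring_of_type_algebra_def)

lemmas scalar_simps = smult_mult_left smult_mult_right scalar_scalar adj_smult adj_mult adj_add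

declare adj_closed [simp, intro] adj_adj [simp]

lemma adj_one: "adj A \<one> = \<one>"
  using adj_mult[of "adj A \<one>" \<one>] by simp

lemma adj_zero: "adj A \<zero> = \<zero>"
  using adj_smult[of \<zero> 0] by simp

lemma cnorm_zero [simp]: "cnorm A \<zero> = 0"
  by (simp add: cnorm_eq_zero)

text \<open>The identity \<open>\<parallel>x\<^sup>* x\<parallel> = \<parallel>x\<parallel>\<^sup>2\<close> and submultiplicativity give \<open>\<parallel>x\<parallel> \<le> \<parallel>x\<^sup>*\<parallel>\<close>; the
  reverse inequality is the same one for \<open>x\<^sup>*\<close>.\<close>

lemma cnorm_adj: "x \<in> carrier A \<Longrightarrow> cnorm A (adj A x) = cnorm A x"
proof -
  have le: "cnorm A x \<le> cnorm A (adj A x)" if x: "x \<in> carrier A" for x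
  proof (cases "cnorm A x = 0")
    case True
    then show ?thesis using x cnorm_nonneg by simp
  next
    case False
    then have "0 < cnorm A x"
      using x cnorm_nonneg[of x] by simp
    moreover have "cnorm A x * cnorm A x \<le> cnorm A (adj A x) * cnorm A x"
      using cstar_identity[OF x] cnorm_mult[of "adj A x" x] x by (simp add: power2_eq_square)
    ultimately show ?thesis by simp
  qed
  assume "x \<in> carrier A"
  then show ?thesis using le[of x] le[of "adj A x"] by simp
qed

lemma adj_diff:
  assumes "x \<in> carrier A" "y \<in> carrier A"
  shows "adj A (x \<ominus> y) = adj A x \<ominus> adj A y"
proof -
  have "adj A x = adj A ((x \<ominus> y) \<oplus> y)"
    using assms by (simp add: minus_eq a_assoc l_neg)
  also have "\<dots> = adj A (x \<ominus> y) \<oplus> adj A y"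
    using assms by (simp add: adj_add)
  finally show ?thesis
    using assms by (simp add: minus_eq a_assoc r_neg)
qed

lemma cdist_carrier:
  "x \<in> carrier A \<Longrightarrow> y \<in> carrier A \<Longrightarrow> cdist A x y = cnorm A (x \<ominus> y)"
  by (simp add: cdist_def)

lemma cnorm_triangle_cdist:
  "\<lbrakk>x \<in> carrier A; y \<in> carrier A; z \<in> carrier A\<rbrakk>
    \<Longrightarrow> cnorm A (x \<ominus> z) \<le> cnorm A (x \<ominus> y) + cnorm A (y \<ominus> z)"
  using Metric_space.triangle[OF Metric_space_cdist, of x y z] by (simp add: cdist_def)

lemma unitaryI:
  "x \<in> carrier A \<Longrightarrow> adj A x \<otimes> x = \<one> \<Longrightarrow> x \<otimes> adj A x = \<one> \<Longrightarrow> unitary A x"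
  by (simp add: unitary_def)

lemma unitary_closed: "unitary A x \<Longrightarrow> x \<in> carrier A"
  and unitary_adj: "unitary A x \<Longrightarrow> unitary A (adj A x)"
  and unitary_left: "unitary A x \<Longrightarrow> adj A x \<otimes> x = \<one>"
  and unitary_right: "unitary A x \<Longrightarrow> x \<otimes> adj A x = \<one>"
  and unitary_one: "unitary A \<one>"
  by (auto simp: unitary_def adj_one)

declare unitary_closed [simp, intro]

lemma unitary_cancel:
  assumes "unitary A x" "y \<in> carrier A"
  shows "adj A x \<otimes> (x \<otimes> y) = y" "x \<otimes> (adj A x \<otimes> y) = y"
  using assms unitary_left[of x] unitary_right[of x] by (simp_all flip: m_assoc)

lemma unitary_mult:
  assumes "unitary A x" "unitary A y"
  shows "unitary A (x \<otimes> y)"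
  by (rule unitaryI) (use assms in \<open>simp_all add: adj_mult m_assoc unitary_cancel unitary_left unitary_right\<close>)

lemma unitary_scalar:
  assumes "unitary A x" "cmod c = 1"
  shows "unitary A (c \<odot> x)"
proof -
  have "c * cnj c = 1"
    using complex_norm_square[of c] assms(2) by simp
  moreover have "cnj c * c = 1"
    using \<open>c * cnj c = 1\<close> by (simp only: mult.commute)
  ultimately show ?thesis
    by (intro unitaryI)
      (use assms(1) in \<open>simp_all add: scalar_simps unitary_left unitary_right\<close>)
qed

lemma unitary_Units: "unitary A x \<Longrightarrow> x \<in> Units A"
  unfolding unitary_def Units_def using adj_closed by blast

lemma unitary_inv: "unitary A x \<Longrightarrow> inv x = adj A x"
  by (rule inv_char) (simp_all add: unitary_left unitary_right)

text \<open>Only the upper bound is claimed, since in the zero algebra a unitary has norm 0.  From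
  \<open>\<parallel>\<one>\<parallel>\<^sup>2 = \<parallel>\<one>\<parallel>\<close> the norm of \<open>\<one>\<close> is 0 or 1, and \<open>\<parallel>x\<parallel>\<^sup>2 = \<parallel>x\<^sup>* x\<parallel> = \<parallel>\<one>\<parallel>\<close>.\<close>

lemma cnorm_unitary_le:
  assumes "unitary A x"
  shows "cnorm A x \<le> 1"
proof -
  have "(cnorm A \<one>)\<^sup>2 = cnorm A \<one>"
    using cstar_identity[of \<one>] by (simp add: adj_one)
  then have "cnorm A \<one> \<le> 1"
    by (auto simp: power2_eq_square)
  then have "(cnorm A x)\<^sup>2 \<le> 1\<^sup>2"
    using cstar_identity[of x] assms by (simp add: unitary_left)
  then show ?thesis by (rule power2_le_imp_le) simp
qed

text \<open>For a unitary \<open>x\<close> a negative power is the adjoint of a positive one, so whatever passes from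
  \<open>y\<close> to \<open>y x\<close> and to \<open>y\<^sup>*\<close> holds for all integer powers.\<close>

lemma unitary_int_pow_induct:
  fixes m :: int
  assumes x: "unitary A x" and "P \<one>"
    and mult: "\<And>y. unitary A y \<Longrightarrow> P y \<Longrightarrow> P (y \<otimes> x)"
    and adj: "\<And>y. unitary A y \<Longrightarrow> P y \<Longrightarrow> P (adj A y)"
  shows "unitary A (x [^] m) \<and> P (x [^] m)"
proof -
  have nat: "unitary A (x [^] k) \<and> P (x [^] k)" for k :: nat
    by (induction k) (use x \<open>P \<one>\<close> in \<open>auto intro: unitary_one unitary_mult mult\<close>)
  then have "inv (x [^] k) = adj A (x [^] k)" for k :: nat
    by (simp add: unitary_inv)
  then have "x [^] m = (if m < 0 then adj A (x [^] nat (- m)) else x [^] nat m)"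
    by (simp only: int_pow_def2)
  moreover have "unitary A (adj A (x [^] k)) \<and> P (adj A (x [^] k))" for k :: nat
    using nat by (blast intro: unitary_adj adj)
  ultimately show ?thesis
    using nat by (cases "m < 0") (simp_all only: if_True if_False simp_thms)
qed

lemma unitary_int_pow: "unitary A x \<Longrightarrow> unitary A (x [^] (m::int))"
  using unitary_int_pow_induct[of x "\<lambda>_. True"] by blast

text \<open>Unitaries are units, so this is the power law in the group of units; the powers computed there
  agree with those of the ring.\<close>

lemma unitary_int_pow_add:
  fixes m k :: int
  assumes "unitary A x"
  shows "x [^] (m + k) = x [^] m \<otimes> x [^] k"
proof -
  have units: "x [^]\<^bsub>units_of A\<^esub> j = x [^] j" for j :: int
    using unitary_Units[OF assms] Units_pow_closed
    by (simp only: int_pow_def2 units_of_pow units_of_inv)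
  show ?thesis
    using group.int_pow_mult[OF units_group, of x m k] unitary_Units[OF assms]
    by (simp add: units units_of_carrier units_of_mult)
qed

end

text \<open>The estimates below see coefficients only through their absolute values, so a phase may stay
  unspecified.  Keeping it existential makes the relation pass to products and adjoints, hence to all
  integer powers, without any bookkeeping of exponents.\<close>

definition phase_commute :: "('a, 'm) cstar_scheme \<Rightarrow> 'a \<Rightarrow> 'a \<Rightarrow> bool" where
  "phase_commute A x y \<longleftrightarrow> (\<exists>\<kappa>. cmod \<kappa> = 1 \<and> x \<otimes>\<^bsub>A\<^esub> y = \<kappa> \<odot>\<^bsub>A\<^esub> (y \<otimes>\<^bsub>A\<^esub> x))"

context unital_cstar_algebra
begin

lemma phase_commute_sym:
  assumes "phase_commute A x y" "x \<in> carrier A" "y \<in> carrier A"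
  shows "phase_commute A y x"
proof -
  obtain \<kappa> where "cmod \<kappa> = 1" "x \<otimes> y = \<kappa> \<odot> (y \<otimes> x)"
    using assms(1) by (auto simp: phase_commute_def)
  moreover from \<open>cmod \<kappa> = 1\<close> have "inverse \<kappa> * \<kappa> = 1"
    by (metis left_inverse norm_zero zero_neq_one)
  ultimately show ?thesis
    unfolding phase_commute_def using assms
    by (intro exI[of _ "inverse \<kappa>"]) (simp add: norm_inverse scalar_scalar)
qed

lemma phase_commute_one: "x \<in> carrier A \<Longrightarrow> phase_commute A x \<one>"
  unfolding phase_commute_def by (intro exI[of _ 1]) simp

lemma phase_commute_mult:
  assumes "phase_commute A x y" "phase_commute A x z"
    and [simp]: "x \<in> carrier A" "y \<in> carrier A" "z \<in> carrier A"
  shows "phase_commute A x (y \<otimes> z)"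
proof -
  obtain \<kappa> \<mu> where 1: "cmod \<kappa> = 1" "x \<otimes> y = \<kappa> \<odot> (y \<otimes> x)"
    and 2: "cmod \<mu> = 1" "x \<otimes> z = \<mu> \<odot> (z \<otimes> x)"
    using assms(1,2) by (auto simp: phase_commute_def)
  have "x \<otimes> (y \<otimes> z) = (x \<otimes> y) \<otimes> z" by (simp add: m_assoc)
  also have "\<dots> = \<kappa> \<odot> (y \<otimes> (x \<otimes> z))" by (simp add: 1 scalar_simps m_assoc)
  also have "\<dots> = (\<kappa> * \<mu>) \<odot> ((y \<otimes> z) \<otimes> x)" by (simp add: 2 scalar_simps m_assoc)
  finally show ?thesis
    unfolding phase_commute_def using 1 2 by (intro exI[of _ "\<kappa> * \<mu>"]) (simp add: norm_mult)
qed

text \<open>With \<open>y x = \<kappa> x y\<close>, insert \<open>y\<^sup>* y = \<one>\<close> in front of \<open>x y\<^sup>*\<close> and let \<open>y\<close> pass \<open>x\<close>.\<close>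

lemma phase_commute_adj:
  assumes "phase_commute A x y" and [simp]: "x \<in> carrier A" and y: "unitary A y"
  shows "phase_commute A x (adj A y)"
proof -
  obtain \<kappa> where \<kappa>: "cmod \<kappa> = 1" "y \<otimes> x = \<kappa> \<odot> (x \<otimes> y)"
    using phase_commute_sym[OF assms(1)] y by (auto simp: phase_commute_def)
  have "x \<otimes> adj A y = adj A y \<otimes> (y \<otimes> x) \<otimes> adj A y"
    using y by (simp add: unitary_cancel)
  also have "\<dots> = \<kappa> \<odot> (adj A y \<otimes> x)"
    using y by (simp add: \<kappa> scalar_simps m_assoc unitary_right)
  finally show ?thesis using \<kappa> by (auto simp: phase_commute_def)
qed

lemma phase_commute_int_pow:
  fixes m n :: int
  assumes "phase_commute A x y" "unitary A x" "unitary A y"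
  shows "phase_commute A (x [^] m) (y [^] n)"
proof -
  have right: "phase_commute A z (t [^] n)"
    if "phase_commute A z t" "unitary A z" "unitary A t" for z t and n :: int
    using unitary_int_pow_induct[of t "phase_commute A z" n] that
    by (auto intro: phase_commute_one phase_commute_mult phase_commute_adj)
  have "phase_commute A (y [^] n) x"
    using right[OF assms] by (rule phase_commute_sym) (use assms in \<open>auto intro: unitary_int_pow\<close>)
  then have "phase_commute A (y [^] n) (x [^] m)"
    using right assms unitary_int_pow by blast
  then show ?thesis
    by (rule phase_commute_sym) (use assms in \<open>auto intro: unitary_int_pow\<close>)
qed

end

section \<open>Fourier partial sums\<close>

locale rotation_unitaries = unital_cstar_algebra A
  for A :: "('a, 'm) cstar_scheme" (structure) +
  fixes \<theta> :: real and U V :: 'a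
  assumes rotation_pair: "rotation_pair \<theta> A U V"
begin

definition monomial :: "int \<times> int \<Rightarrow> 'a" where
  "monomial p = U [^] fst p \<otimes> V [^] snd p"

definition fourier_sum :: "(int \<times> int \<Rightarrow> complex) \<Rightarrow> (int \<times> int) set \<Rightarrow> 'a" where
  "fourier_sum a F = (\<Oplus>p\<in>F. a p \<odot> monomial p)"

lemma unitary_U: "unitary A U" and unitary_V: "unitary A V"
  using rotation_pair by (auto simp: rotation_pair_def)

lemma unitary_monomial: "unitary A (monomial p)"
  by (auto simp: monomial_def intro: unitary_mult unitary_int_pow unitary_U unitary_V)

lemma monomial_closed [simp, intro]: "monomial p \<in> carrier A"
  by (rule unitary_closed[OF unitary_monomial])

lemma monomial_mult: "\<exists>\<kappa>. cmod \<kappa> = 1 \<and> monomial p \<otimes> monomial q = \<kappa> \<odot> monomial (p + q)"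
proof -
  obtain m n k l where p: "p = (m, n)" and q: "q = (k, l)" by (metis surj_pair)
  have [simp]: "U [^] j \<in> carrier A" "V [^] j \<in> carrier A" for j :: int
    using unitary_int_pow unitary_U unitary_V by blast+
  have "phase_commute A U V"
    using rotation_pair unfolding rotation_pair_def phase_commute_def
    by (auto simp: norm_exp_eq_Re intro!: exI[of _ "exp (2 * of_real pi * \<i> * of_real \<theta>)"])
  then have "phase_commute A (V [^] n) (U [^] k)"
    by (intro phase_commute_sym[OF phase_commute_int_pow] unitary_U unitary_V) auto
  then obtain \<kappa> where \<kappa>: "cmod \<kappa> = 1" "V [^] n \<otimes> U [^] k = \<kappa> \<odot> (U [^] k \<otimes> V [^] n)"
    by (auto simp: phase_commute_def)
  have "monomial p \<otimes> monomial q = U [^] m \<otimes> (V [^] n \<otimes> U [^] k) \<otimes> V [^] l"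
    by (simp add: monomial_def p q m_assoc)
  also have "\<dots> = \<kappa> \<odot> monomial (p + q)"
    by (simp add: \<kappa> monomial_def p q scalar_simps m_assoc unitary_int_pow_add unitary_U unitary_V)
  finally show ?thesis using \<kappa> by blast
qed

text \<open>The adjoint is the inverse, and \<open>monomial (- p)\<close> is the inverse up to a phase because
  \<open>monomial 0 = \<one>\<close>.\<close>

lemma monomial_adj: "\<exists>\<kappa>. cmod \<kappa> = 1 \<and> adj A (monomial p) = \<kappa> \<odot> monomial (- p)"
proof -
  obtain \<kappa> where \<kappa>: "cmod \<kappa> = 1" "monomial p \<otimes> monomial (- p) = \<kappa> \<odot> monomial 0"
    using monomial_mult[of p "- p"] by auto
  have "monomial 0 = \<one>" by (simp add: monomial_def)
  have "monomial (- p) = adj A (monomial p) \<otimes> (\<kappa> \<odot> \<one>)"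
    using unitary_cancel(1)[OF unitary_monomial, of "monomial (- p)" p] by (simp add: \<kappa> \<open>monomial 0 = \<one>\<close>)
  then have "inverse \<kappa> \<odot> monomial (- p) = (inverse \<kappa> * \<kappa>) \<odot> adj A (monomial p)"
    by (simp add: scalar_simps)
  moreover have "inverse \<kappa> * \<kappa> = 1"
    using \<kappa>(1) by (metis left_inverse norm_zero zero_neq_one)
  ultimately show ?thesis
    using \<kappa>(1) by (intro exI[of _ "inverse \<kappa>"]) (simp add: norm_inverse)
qed

lemma fourier_sum_empty [simp]: "fourier_sum a {} = \<zero>"
  by (simp add: fourier_sum_def)

lemma fourier_sum_closed [simp, intro]: "fourier_sum a F \<in> carrier A"
  by (auto simp: fourier_sum_def intro: finsum_closed)

lemma fourier_sum_insert:
  "finite F \<Longrightarrow> p \<notin> F \<Longrightarrow> fourier_sum a (insert p F) = a p \<odot> monomial p \<oplus> fourier_sum a F"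
  by (auto simp: fourier_sum_def)

lemma fourier_sum_add: "fourier_sum (\<lambda>p. a p + b p) F = fourier_sum a F \<oplus> fourier_sum b F"
  by (simp add: fourier_sum_def scalar_add finsum_addf Pi_def)

lemma fourier_sum_diff: "finite F \<Longrightarrow> fourier_sum (\<lambda>p. a p - b p) F = fourier_sum a F \<ominus> fourier_sum b F"
  using fourier_sum_add[of "\<lambda>p. a p - b p" b F] by (simp add: minus_eq a_assoc r_neg)

lemma fourier_sum_single:
  assumes "finite F" "p \<in> F"
  shows "fourier_sum (\<lambda>q. if q = p then c else 0) F = c \<odot> monomial p"
proof -
  have "fourier_sum (\<lambda>q. if q = p then c else 0) F = (\<Oplus>q\<in>F. if p = q then c \<odot> monomial q else \<zero>)"
    unfolding fourier_sum_def by (rule finsum_cong') auto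
  then show ?thesis using finsum_singleton[OF assms(2,1), of "\<lambda>q. c \<odot> monomial q"] by simp
qed

lemma cnorm_fourier_sum_le:
  assumes "finite F"
  shows "cnorm A (fourier_sum a F) \<le> (\<Sum>p\<in>F. cmod (a p))"
  using assms
proof (induction F rule: finite_induct)
  case (insert p F)
  have "cnorm A (a p \<odot> monomial p) \<le> cmod (a p)"
    using cnorm_unitary_le[OF unitary_monomial, of p]
    by (simp add: cnorm_smult mult_left_le)
  then show ?case
    using insert cnorm_triangle[of "a p \<odot> monomial p" "fourier_sum a F"] by (simp add: fourier_sum_insert)
qed simp

text \<open>The index set \<open>G\<close> may exceed the set of sums \<open>F + H\<close>, because the product is to be compared with
  all sufficiently large partial sums of the convolution series.\<close>

lemma fourier_sum_mult:
  assumes \<kappa>: "\<And>p q. monomial p \<otimes> monomial q = \<kappa> (p, q) \<odot> monomial (p + q)"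
    and "finite F" "finite H" "finite G"
    and "\<And>p q. p \<in> F \<Longrightarrow> q \<in> H \<Longrightarrow> p + q \<in> G"
  shows "fourier_sum a F \<otimes> fourier_sum b H =
    fourier_sum (\<lambda>r. \<Sum>p\<in>F. \<Sum>q\<in>H. if r = p + q then a p * b q * \<kappa> (p, q) else 0) G"
proof -
  have zero: "fourier_sum (\<lambda>_. 0) G = \<zero>"
    by (simp add: fourier_sum_def)
  have left: "(a p \<odot> monomial p) \<otimes> fourier_sum b H =
      fourier_sum (\<lambda>r. \<Sum>q\<in>H. if r = p + q then a p * b q * \<kappa> (p, q) else 0) G"
    if "\<And>q. q \<in> H \<Longrightarrow> p + q \<in> G" for p
    using \<open>finite H\<close> that
  proof (induction H rule: finite_induct)
    case empty
    then show ?case by (simp add: zero)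
  next
    case (insert q H)
    have "(a p \<odot> monomial p) \<otimes> (b q \<odot> monomial q) = (a p * b q * \<kappa> (p, q)) \<odot> monomial (p + q)"
      by (simp add: scalar_simps \<kappa> mult_ac)
    also have "\<dots> = fourier_sum (\<lambda>r. if r = p + q then a p * b q * \<kappa> (p, q) else 0) G"
      using \<open>finite G\<close> insert.prems by (simp add: fourier_sum_single)
    finally show ?case
      using insert by (simp add: fourier_sum_insert r_distr fourier_sum_add)
  qed
  show ?thesis
    using \<open>finite F\<close> assms(5)
  proof (induction F rule: finite_induct)
    case empty
    then show ?case by (simp add: zero)
  next
    case (insert p F)
    then show ?case by (simp add: fourier_sum_insert l_distr fourier_sum_add left)
  qed
qed

end

section \<open>Summable families on \<open>\<int>\<^sup>2\<close>\<close>

lemma summable_on_prod_mult: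
  fixes f :: "'a \<Rightarrow> real" and g :: "'b \<Rightarrow> real"
  assumes f: "f summable_on UNIV" "\<And>x. 0 \<le> f x" and g: "g summable_on UNIV" "\<And>y. 0 \<le> g y"
  shows "(\<lambda>p. f (fst p) * g (snd p)) summable_on UNIV"
proof -
  have "(\<lambda>p. f (fst p) * g (snd p)) summable_on Sigma UNIV (\<lambda>_. UNIV)"
    by (rule summable_on_SigmaI[where g = "\<lambda>x. f x * infsum g UNIV"])
      (use assms in \<open>auto intro!: has_sum_cmult_right has_sum_infsum summable_on_cmult_left\<close>)
  then show ?thesis by simp
qed

lemma summable_on_int_inverse_square:
  "(\<lambda>m::int. inverse ((1 + \<bar>real_of_int m\<bar>)\<^sup>2)) summable_on UNIV" (is "?f summable_on _")
proof -
  have "summable (\<lambda>n. (inverse (real (Suc n))) ^ 2)"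
    using inverse_power_summable[of 2, where 'a = real] by (subst summable_Suc_iff) (simp add: power_inverse)
  then have nat: "(\<lambda>n. inverse ((1 + real n)\<^sup>2)) summable_on UNIV"
    by (intro summable_nonneg_imp_summable_on) (simp_all add: power_inverse)
  have "?f summable_on range int"
    by (subst summable_on_reindex) (use nat in \<open>simp_all add: o_def\<close>)
  moreover have "?f summable_on range (\<lambda>n. - int n)"
    by (subst summable_on_reindex) (use nat in \<open>simp_all add: o_def inj_on_def\<close>)
  ultimately have "?f summable_on (range int \<union> range (\<lambda>n. - int n))"
    by (rule summable_on_union)
  moreover have "range int \<union> range (\<lambda>n. - int n) = UNIV"
    by (auto intro: int_cases2)
  ultimately show ?thesis by simp
qed

text \<open>The fibres of \<open>g\<close> are disjoint, so summing along finitely many of them counts no point twice.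
  The excluded set \<open>S\<close> lets the bound be a tail of the series.\<close>

lemma infsum_fibres_le:
  fixes h :: "'a \<Rightarrow> real"
  assumes h: "h summable_on UNIV" "\<And>x. 0 \<le> h x" and "finite G"
  shows "(\<Sum>r\<in>G. infsum h ({x. g x = r} - S)) \<le> infsum h (UNIV - S)"
proof -
  have sub: "h summable_on B" for B
    using h(1) by (rule summable_on_subset) simp
  have "(\<Sum>r\<in>G. infsum h ({x. g x = r} - S)) = infsum h ({x. g x \<in> G} - S)"
    using \<open>finite G\<close>
  proof (induction G rule: finite_induct)
    case (insert r G)
    have "{x. g x \<in> insert r G} - S = ({x. g x = r} - S) \<union> ({x. g x \<in> G} - S)"
      by auto
    then show ?case
      using insert by (simp, subst infsum_Un_disjoint) (auto simp: sub)
  qed simp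
  also have "\<dots> \<le> infsum h (UNIV - S)"
    by (rule infsum_mono_neutral) (use sub h(2) in auto)
  finally show ?thesis .
qed

lemma infsum_tail_less:
  fixes h :: "'a \<Rightarrow> real"
  assumes h: "h summable_on UNIV" and "0 < e"
  obtains S where "finite S" "\<And>T. finite T \<Longrightarrow> S \<subseteq> T \<Longrightarrow> infsum h (UNIV - T) < e"
proof -
  have "(sum h \<longlongrightarrow> infsum h UNIV) (finite_subsets_at_top UNIV)"
    using has_sum_infsum[OF h] by (simp add: has_sum_def)
  then have "\<forall>\<^sub>F T in finite_subsets_at_top UNIV. dist (sum h T) (infsum h UNIV) < e"
    using \<open>0 < e\<close> by (rule tendstoD)
  then obtain S where S: "finite S" "\<And>T. finite T \<Longrightarrow> S \<subseteq> T \<Longrightarrow> dist (sum h T) (infsum h UNIV) < e"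
    by (auto simp: eventually_finite_subsets_at_top)
  have "infsum h (UNIV - T) < e" if "finite T" "S \<subseteq> T" for T
  proof -
    have "infsum h (UNIV - T) = infsum h UNIV - sum h T"
      using that h by (subst infsum_Diff) (auto intro: summable_on_subset[OF h])
    then show ?thesis using S(2)[OF that] by (simp add: dist_real_def)
  qed
  with S(1) show ?thesis using that by blast
qed

text \<open>Submultiplicativity of the weight (\<open>weight_add_le\<close>) lets a factor \<open>weight (p + q) ^ k\<close> be
  distributed over the two factors of a convolution, so convolution preserves rapid decrease.\<close>

definition weight :: "int \<times> int \<Rightarrow> real" where
  "weight p = 1 + \<bar>real_of_int (fst p)\<bar> + \<bar>real_of_int (snd p)\<bar>"

lemma weight_ge_1: "1 \<le> weight p"
  by (simp add: weight_def)

lemma weight_uminus [simp]: "weight (- p) = weight p"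
  by (simp add: weight_def)

lemma weight_add_le: "weight (p + q) \<le> weight p * weight q"
proof -
  have "weight (p + q) \<le> weight p + weight q - 1"
    by (auto simp: weight_def)
  also have "\<dots> \<le> weight p * weight q"
    using mult_nonneg_nonneg[of "weight p - 1" "weight q - 1"] weight_ge_1[of p] weight_ge_1[of q]
    by (simp add: algebra_simps)
  finally show ?thesis .
qed

lemma rapidly_decreasing_weight:
  "rapidly_decreasing a \<longleftrightarrow> (\<forall>k. \<exists>C. \<forall>p. weight p ^ k * cmod (a p) \<le> C)"
  by (simp add: rapidly_decreasing_def weight_def split_paired_All)

text \<open>Four further powers of the weight dominate \<open>(1 + \<bar>m\<bar>)\<^sup>2 (1 + \<bar>n\<bar>)\<^sup>2\<close>, whose inverse is a product
  of two summable families on \<open>\<int>\<close>.\<close>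

lemma rapidly_decreasing_summable:
  assumes "rapidly_decreasing a"
  shows "(\<lambda>p. weight p ^ k * cmod (a p)) summable_on UNIV"
proof -
  obtain C where C: "\<And>p. weight p ^ (k + 4) * cmod (a p) \<le> C"
    using assms unfolding rapidly_decreasing_weight by blast
  define f :: "int \<Rightarrow> real" where "f = (\<lambda>m. inverse ((1 + \<bar>real_of_int m\<bar>)\<^sup>2))"
  have "(\<lambda>p. f (fst p) * f (snd p)) summable_on UNIV"
    unfolding f_def by (intro summable_on_prod_mult summable_on_int_inverse_square) auto
  then have "(\<lambda>p. C * (f (fst p) * f (snd p))) summable_on UNIV"
    by (rule summable_on_cmult_right)
  then show ?thesis
  proof (rule summable_on_comparison_test)
    fix p :: "int \<times> int"
    show "0 \<le> weight p ^ k * cmod (a p)"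
      using weight_ge_1[of p] by simp
    define s t where "s = 1 + \<bar>real_of_int (fst p)\<bar>" and "t = 1 + \<bar>real_of_int (snd p)\<bar>"
    have pos: "0 < s" "0 < t" by (auto simp: s_def t_def)
    have "s\<^sup>2 * t\<^sup>2 \<le> weight p ^ 2 * weight p ^ 2"
      by (intro mult_mono power_mono) (auto simp: s_def t_def weight_def)
    then have "s\<^sup>2 * t\<^sup>2 * (weight p ^ k * cmod (a p)) \<le> weight p ^ 4 * (weight p ^ k * cmod (a p))"
      using weight_ge_1[of p] by (intro mult_right_mono) (simp_all flip: power_add)
    also have "\<dots> \<le> C"
      using C[of p] by (simp add: power_add mult_ac)
    finally show "weight p ^ k * cmod (a p) \<le> C * (f (fst p) * f (snd p))"
      using pos by (simp add: f_def flip: s_def t_def) (simp add: field_simps)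
  qed
qed

text \<open>Sums over a fibre are taken inside the index set of pairs, which avoids any substitution
  \<open>q = r - p\<close>: all estimates become comparisons with one series over pairs.\<close>

definition fibre :: "int \<times> int \<Rightarrow> ((int \<times> int) \<times> (int \<times> int)) set" where
  "fibre r = {x. fst x + snd x = r}"

definition twisted_convolution ::
  "((int \<times> int) \<times> (int \<times> int) \<Rightarrow> complex) \<Rightarrow> (int \<times> int \<Rightarrow> complex) \<Rightarrow> (int \<times> int \<Rightarrow> complex)
    \<Rightarrow> int \<times> int \<Rightarrow> complex" where
  "twisted_convolution \<kappa> a b r = (\<Sum>\<^sub>\<infinity>x\<in>fibre r. a (fst x) * b (snd x) * \<kappa> x)"

text \<open>On the fibre over \<open>r\<close> the weight of \<open>r\<close> is at most the product of the two weights, so the weighted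
  coefficient is bounded by the full sum over pairs of \<open>weight p ^ k * \<bar>a p\<bar> * weight q ^ k * \<bar>b q\<bar>\<close>,
  which is finite and independent of \<open>r\<close>.\<close>

lemma rapidly_decreasing_twisted_convolution:
  assumes a: "rapidly_decreasing a" and b: "rapidly_decreasing b" and \<kappa>: "\<And>x. cmod (\<kappa> x) = 1"
  shows "rapidly_decreasing (twisted_convolution \<kappa> a b)"
  unfolding rapidly_decreasing_weight
proof (intro allI exI)
  fix k r
  define h where "h x = (weight (fst x) ^ k * cmod (a (fst x))) * (weight (snd x) ^ k * cmod (b (snd x)))"
    for x
  define \<alpha> where "\<alpha> x = a (fst x) * b (snd x) * \<kappa> x" for x
  have w: "0 \<le> weight p" for p using weight_ge_1[of p] by simp
  have h0: "0 \<le> h x" for x by (simp add: h_def w)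
  have h: "h summable_on UNIV"
    unfolding h_def
    by (intro summable_on_prod_mult[of "\<lambda>p. weight p ^ k * cmod (a p)" "\<lambda>p. weight p ^ k * cmod (b p)"]
        rapidly_decreasing_summable a b) (simp_all add: w)
  have "1 \<le> weight (fst x) ^ k * weight (snd x) ^ k" for x
    using mult_mono[OF one_le_power[OF weight_ge_1] one_le_power[OF weight_ge_1], of "fst x" k "snd x" k]
    by (simp add: w)
  then have "1 * cmod (\<alpha> x) \<le> weight (fst x) ^ k * weight (snd x) ^ k * cmod (\<alpha> x)" for x
    by (intro mult_right_mono) auto
  then have \<alpha>h: "cmod (\<alpha> x) \<le> h x" for x
    by (simp add: \<alpha>_def h_def norm_mult \<kappa> mult_ac)
  have "(\<lambda>x. cmod (\<alpha> x)) summable_on UNIV"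
    using h by (rule summable_on_comparison_test) (use \<alpha>h in auto)
  then have \<alpha>: "(\<lambda>x. cmod (\<alpha> x)) summable_on fibre r"
    by (rule summable_on_subset) simp
  have "weight r ^ k * cmod (twisted_convolution \<kappa> a b r) \<le> weight r ^ k * (\<Sum>\<^sub>\<infinity>x\<in>fibre r. cmod (\<alpha> x))"
    using norm_infsum_bound[OF \<alpha>] w
    by (intro mult_left_mono) (simp_all add: twisted_convolution_def \<alpha>_def)
  also have "\<dots> = (\<Sum>\<^sub>\<infinity>x\<in>fibre r. weight r ^ k * cmod (\<alpha> x))"
    by (rule infsum_cmult_right'[symmetric])
  also have "\<dots> \<le> infsum h UNIV"
  proof (rule infsum_mono_neutral)
    show "(\<lambda>x. weight r ^ k * cmod (\<alpha> x)) summable_on fibre r"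
      using \<alpha> by (rule summable_on_cmult_right)
    show "weight r ^ k * cmod (\<alpha> x) \<le> h x" if "x \<in> fibre r \<inter> UNIV" for x
    proof -
      have "weight r ^ k \<le> (weight (fst x) * weight (snd x)) ^ k"
        using that weight_add_le[of "fst x" "snd x"] w by (intro power_mono) (auto simp: fibre_def)
      then have "weight r ^ k * cmod (\<alpha> x) \<le> (weight (fst x) * weight (snd x)) ^ k * cmod (\<alpha> x)"
        by (rule mult_right_mono) simp
      then show ?thesis
        by (simp add: \<alpha>_def h_def norm_mult \<kappa> power_mult_distrib mult_ac)
    qed
  qed (use h h0 in auto)
  finally show "weight r ^ k * cmod (twisted_convolution \<kappa> a b r) \<le> infsum h UNIV" .
qed

section \<open>The smooth subalgebra is a \<open>*\<close>-subalgebra\<close>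

context rotation_unitaries
begin

definition fourier_series :: "(int \<times> int \<Rightarrow> complex) \<Rightarrow> 'a \<Rightarrow> bool" where
  "fourier_series a x \<longleftrightarrow> x \<in> carrier A \<and>
     (\<forall>e>0. \<exists>F. finite F \<and> (\<forall>G. finite G \<and> F \<subseteq> G \<longrightarrow> cnorm A (fourier_sum a G \<ominus> x) < e))"

lemma smooth_subalgebra_iff:
  "x \<in> smooth_subalgebra A U V \<longleftrightarrow> (\<exists>a. rapidly_decreasing a \<and> fourier_series a x)"
proof -
  interpret metric: Metric_space "carrier A" "cdist A" by (rule Metric_space_cdist)
  have "limitin (norm_topology A) (fourier_sum a) x (finite_subsets_at_top UNIV) \<longleftrightarrow> fourier_series a x"
    for a
    unfolding norm_topology_def metric.limitin_metric fourier_series_def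
    by (auto simp: eventually_finite_subsets_at_top cdist_carrier)
  then show ?thesis
    by (auto simp: smooth_subalgebra_def fourier_sum_def[abs_def] monomial_def fourier_series_def)
qed

lemma smooth_closed: "x \<in> smooth_subalgebra A U V \<Longrightarrow> x \<in> carrier A"
  by (simp add: smooth_subalgebra_def)

lemma smooth_scalar_monomial: "c \<odot> monomial p \<in> smooth_subalgebra A U V"
  unfolding smooth_subalgebra_iff
proof (intro exI conjI)
  let ?a = "\<lambda>q. if q = p then c else 0"
  show "rapidly_decreasing ?a"
    unfolding rapidly_decreasing_weight
    by (intro allI exI[of _ "weight p ^ _ * cmod c"]) (use weight_ge_1[of p] in auto)
  have "cnorm A (fourier_sum ?a G \<ominus> c \<odot> monomial p) < e" if "0 < e" "finite G" "{p} \<subseteq> G" for e G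
    using that by (simp add: fourier_sum_single minus_eq r_neg)
  then show "fourier_series ?a (c \<odot> monomial p)"
    unfolding fourier_series_def by (auto intro!: exI[of _ "{p}"])
qed

text \<open>The adjoint of a partial sum over \<open>G\<close> is a partial sum over \<open>- G\<close> whose coefficients
  are the conjugates of the original ones up to phases, and the adjoint is isometric.\<close>

lemma smooth_adj:
  assumes "x \<in> smooth_subalgebra A U V"
  shows "adj A x \<in> smooth_subalgebra A U V"
proof -
  obtain a where a: "rapidly_decreasing a" "fourier_series a x"
    using assms by (auto simp: smooth_subalgebra_iff)
  obtain \<kappa> where \<kappa>: "\<And>p. cmod (\<kappa> p) = 1" "\<And>p. adj A (monomial p) = \<kappa> p \<odot> monomial (- p)"
    using monomial_adj by metis
  define b where "b q = cnj (a (- q)) * \<kappa> (- q)" for q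
  have sum: "fourier_sum b G = adj A (fourier_sum a (uminus ` G))" if "finite G" for G
    using that
  proof (induction G rule: finite_induct)
    case empty
    then show ?case by (simp add: adj_zero)
  next
    case (insert q G)
    moreover from insert have "- q \<notin> uminus ` G"
      by (metis imageE neg_equal_iff_equal)
    ultimately show ?case
      by (simp add: fourier_sum_insert scalar_simps \<kappa>(2) b_def)
  qed
  have "rapidly_decreasing b"
    unfolding rapidly_decreasing_weight
  proof
    fix k
    obtain C where "\<And>p. weight p ^ k * cmod (a p) \<le> C"
      using a(1) unfolding rapidly_decreasing_weight by blast
    from this[of "- _"] show "\<exists>C. \<forall>p. weight p ^ k * cmod (b p) \<le> C"
      by (intro exI[of _ C]) (simp add: b_def norm_mult \<kappa>(1))
  qed
  moreover have "fourier_series b (adj A x)"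
    unfolding fourier_series_def
  proof (intro conjI allI impI)
    have x: "x \<in> carrier A" using a(2) by (simp add: fourier_series_def)
    then show "adj A x \<in> carrier A" by simp
    fix e :: real
    assume "0 < e"
    then obtain F where F: "finite F" "\<And>G. finite G \<Longrightarrow> F \<subseteq> G \<Longrightarrow> cnorm A (fourier_sum a G \<ominus> x) < e"
      using a(2) by (auto simp: fourier_series_def)
    have "cnorm A (fourier_sum b G \<ominus> adj A x) < e" if G: "finite G" "uminus ` F \<subseteq> G" for G
    proof -
      have "fourier_sum b G \<ominus> adj A x = adj A (fourier_sum a (uminus ` G) \<ominus> x)"
        using x by (simp add: sum G adj_diff)
      moreover have "F \<subseteq> uminus ` G"
        using image_mono[OF G(2), of uminus] by (simp add: image_image)
      ultimately show ?thesis
        using F(2)[of "uminus ` G"] G x by (simp add: cnorm_adj)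
    qed
    then show "\<exists>F. finite F \<and> (\<forall>G. finite G \<and> F \<subseteq> G \<longrightarrow> cnorm A (fourier_sum b G \<ominus> adj A x) < e)"
      using F(1) by (intro exI[of _ "uminus ` F"]) auto
  qed
  ultimately show ?thesis by (auto simp: smooth_subalgebra_iff)
qed

text \<open>Joint continuity of multiplication, along the net of finite partial sums.\<close>

lemma fourier_series_mult_approx:
  assumes a: "fourier_series a x" and b: "fourier_series b y" and e: "0 < e"
  obtains F where "finite F"
    "\<And>G. finite G \<Longrightarrow> F \<subseteq> G \<Longrightarrow> cnorm A (fourier_sum a G \<otimes> fourier_sum b G \<ominus> x \<otimes> y) < e"
proof -
  have [simp]: "x \<in> carrier A" "y \<in> carrier A" using a b by (auto simp: fourier_series_def)
  define M where "M = cnorm A x + cnorm A y + 2"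
  have M: "0 < M" using cnorm_nonneg[of x] cnorm_nonneg[of y] by (simp add: M_def)
  \<comment> \<open>The bound \<open>d \<le> 1\<close> keeps the partial sums of the second factor bounded by \<open>\<parallel>y\<parallel> + 1\<close>; the constant 2
    in \<open>M\<close> leaves room for a strict inequality.\<close>
  define d where "d = min 1 (e / M)"
  have d: "0 < d" "d \<le> 1" "d * M \<le> e"
    using e M by (auto simp: d_def min_def field_simps)
  obtain F1 where F1: "finite F1" "\<And>G. finite G \<Longrightarrow> F1 \<subseteq> G \<Longrightarrow> cnorm A (fourier_sum a G \<ominus> x) < d"
    using a d(1) by (auto simp: fourier_series_def)
  obtain F2 where F2: "finite F2" "\<And>G. finite G \<Longrightarrow> F2 \<subseteq> G \<Longrightarrow> cnorm A (fourier_sum b G \<ominus> y) < d"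
    using b d(1) by (auto simp: fourier_series_def)
  show ?thesis
  proof
    show "finite (F1 \<union> F2)" using F1 F2 by simp
    fix G :: "(int \<times> int) set"
    assume G: "finite G" "F1 \<union> F2 \<subseteq> G"
    define x' y' where "x' = fourier_sum a G" and "y' = fourier_sum b G"
    have [simp]: "x' \<in> carrier A" "y' \<in> carrier A" by (auto simp: x'_def y'_def)
    have dx: "cnorm A (x' \<ominus> x) < d" and dy: "cnorm A (y' \<ominus> y) < d"
      using F1(2) F2(2) G by (auto simp: x'_def y'_def)
    have ny: "cnorm A y' \<le> cnorm A y + 1"
      using cnorm_triangle[of "y' \<ominus> y" y] dy d(2) by (simp add: minus_eq a_assoc l_neg)
    have "cnorm A (x' \<otimes> y' \<ominus> x \<otimes> y) \<le> cnorm A (x' \<otimes> y' \<ominus> x \<otimes> y') + cnorm A (x \<otimes> y' \<ominus> x \<otimes> y)"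
      by (rule cnorm_triangle_cdist) auto
    also have "x' \<otimes> y' \<ominus> x \<otimes> y' = (x' \<ominus> x) \<otimes> y'"
      by (simp add: minus_eq l_distr l_minus)
    also have "x \<otimes> y' \<ominus> x \<otimes> y = x \<otimes> (y' \<ominus> y)"
      by (simp add: minus_eq r_distr r_minus)
    also have "cnorm A ((x' \<ominus> x) \<otimes> y') + cnorm A (x \<otimes> (y' \<ominus> y))
        \<le> cnorm A (x' \<ominus> x) * cnorm A y' + cnorm A x * cnorm A (y' \<ominus> y)"
      by (intro add_mono cnorm_mult) auto
    also have "\<dots> \<le> d * (cnorm A y + 1) + cnorm A x * d"
      using dx dy ny d(1) by (intro add_mono mult_mono) (auto intro: cnorm_nonneg)
    also have "\<dots> < d * M"
      using d(1) by (simp add: M_def algebra_simps)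
    finally show "cnorm A (fourier_sum a G \<otimes> fourier_sum b G \<ominus> x \<otimes> y) < e"
      using d(3) by (simp add: x'_def y'_def)
  qed
qed

text \<open>For a finite set \<open>F\<close> the product of the partial sums over \<open>F\<close> is close to \<open>x y\<close>.  It is a trigonometric
  polynomial with coefficients \<open>d\<close> that miss from the convolution \<open>c\<close> exactly the pairs outside \<open>F \<times> F\<close>.
  Hence on any \<open>G\<close> containing \<open>F + F\<close> the partial sums for \<open>c\<close> and \<open>d\<close> differ in norm by at most the
  sum of \<open>\<bar>a p\<bar> \<bar>b q\<bar>\<close> over all pairs outside \<open>F \<times> F\<close>, a tail of a convergent series.\<close>

lemma fourier_series_mult:
  assumes a: "fourier_series a x" "(\<lambda>p. cmod (a p)) summable_on UNIV"
    and b: "fourier_series b y" "(\<lambda>p. cmod (b p)) summable_on UNIV"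
    and \<kappa>: "\<And>x. cmod (\<kappa> x) = 1" "\<And>p q. monomial p \<otimes> monomial q = \<kappa> (p, q) \<odot> monomial (p + q)"
  shows "fourier_series (twisted_convolution \<kappa> a b) (x \<otimes> y)"
  unfolding fourier_series_def
proof (intro conjI allI impI)
  have [simp]: "x \<in> carrier A" "y \<in> carrier A" using a b by (auto simp: fourier_series_def)
  show "x \<otimes> y \<in> carrier A" by simp
  define \<alpha> where "\<alpha> z = a (fst z) * b (snd z) * \<kappa> z" for z
  have "(\<lambda>z. cmod (a (fst z)) * cmod (b (snd z))) summable_on UNIV"
    by (intro summable_on_prod_mult a b) auto
  then have norm_\<alpha>: "(\<lambda>z. cmod (\<alpha> z)) summable_on UNIV"
    by (simp add: \<alpha>_def norm_mult \<kappa>(1))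
  have norm_sub: "(\<lambda>z. cmod (\<alpha> z)) summable_on S" for S
    using norm_\<alpha> by (rule summable_on_subset) simp
  then have sub: "\<alpha> summable_on S" for S
    by (rule abs_summable_summable)
  fix e :: real
  assume "0 < e"
  then have "0 < e / 2" by simp
  obtain F1 where F1: "finite F1" "\<And>G. finite G \<Longrightarrow> F1 \<subseteq> G \<Longrightarrow>
      cnorm A (fourier_sum a G \<otimes> fourier_sum b G \<ominus> x \<otimes> y) < e / 2"
    using fourier_series_mult_approx[OF a(1) b(1) \<open>0 < e / 2\<close>] by blast
  obtain S where S: "finite S" "\<And>T. finite T \<Longrightarrow> S \<subseteq> T \<Longrightarrow> (\<Sum>\<^sub>\<infinity>z\<in>UNIV - T. cmod (\<alpha> z)) < e / 2"
    using infsum_tail_less[OF norm_\<alpha> \<open>0 < e / 2\<close>] by blast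
  \<comment> \<open>\<open>F \<times> F\<close> must contain the pairs in \<open>S\<close>, hence the two projections of \<open>S\<close>.\<close>
  define F where "F = F1 \<union> fst ` S \<union> snd ` S"
  have F: "finite F" "F1 \<subseteq> F" "S \<subseteq> F \<times> F"
    using F1 S by (force simp: F_def)+
  have "cnorm A (fourier_sum (twisted_convolution \<kappa> a b) G \<ominus> x \<otimes> y) < e"
    if G: "finite G" "(\<lambda>z. fst z + snd z) ` (F \<times> F) \<subseteq> G" for G
  proof -
    define c d where "c = twisted_convolution \<kappa> a b"
      and "d r = (\<Sum>p\<in>F. \<Sum>q\<in>F. if r = p + q then a p * b q * \<kappa> (p, q) else 0)" for r
    have prod: "fourier_sum a F \<otimes> fourier_sum b F = fourier_sum d G"
      unfolding d_def by (rule fourier_sum_mult[OF \<kappa>(2)]) (use F G in force)+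
    have "d r = sum \<alpha> (fibre r \<inter> F \<times> F)" for r
    proof -
      have "d r = (\<Sum>z\<in>F \<times> F. if z \<in> fibre r then \<alpha> z else 0)"
        unfolding d_def \<alpha>_def fibre_def
        by (subst sum.cartesian_product) (rule sum.cong, auto)
      also have "\<dots> = sum \<alpha> (fibre r \<inter> F \<times> F)"
        using F(1) by (subst sum.inter_restrict[symmetric]) (auto simp: Int_commute)
      finally show ?thesis .
    qed
    then have diff: "c r - d r = infsum \<alpha> (fibre r - F \<times> F)" for r
      using infsum_Diff[OF sub sub, of "fibre r \<inter> F \<times> F" "fibre r"] F(1)
      by (simp add: c_def twisted_convolution_def Diff_Int flip: \<alpha>_def)
    have "cnorm A (fourier_sum c G \<ominus> fourier_sum d G) \<le> (\<Sum>r\<in>G. cmod (c r - d r))"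
      using cnorm_fourier_sum_le[OF G(1), of "\<lambda>r. c r - d r"] G(1) by (simp add: fourier_sum_diff)
    also have "\<dots> \<le> (\<Sum>r\<in>G. \<Sum>\<^sub>\<infinity>z\<in>fibre r - F \<times> F. cmod (\<alpha> z))"
      unfolding diff by (intro sum_mono norm_infsum_bound norm_sub)
    also have "\<dots> \<le> (\<Sum>\<^sub>\<infinity>z\<in>UNIV - F \<times> F. cmod (\<alpha> z))"
      unfolding fibre_def by (rule infsum_fibres_le[OF norm_\<alpha>]) (use G in auto)
    also have "\<dots> < e / 2"
      using F by (intro S(2)) auto
    finally have "cnorm A (fourier_sum c G \<ominus> fourier_sum d G) < e / 2" .
    moreover have "cnorm A (fourier_sum d G \<ominus> x \<otimes> y) < e / 2"
      using F1(2)[OF F(1,2)] by (simp add: prod)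
    ultimately show ?thesis
      using cnorm_triangle_cdist[of "fourier_sum c G" "fourier_sum d G" "x \<otimes> y"]
      by (simp add: c_def)
  qed
  then show "\<exists>F. finite F \<and> (\<forall>G. finite G \<and> F \<subseteq> G \<longrightarrow>
      cnorm A (fourier_sum (twisted_convolution \<kappa> a b) G \<ominus> x \<otimes> y) < e)"
    using F(1) by (intro exI[of _ "(\<lambda>z. fst z + snd z) ` (F \<times> F)"]) auto
qed

lemma smooth_mult:
  assumes "x \<in> smooth_subalgebra A U V" "y \<in> smooth_subalgebra A U V"
  shows "x \<otimes> y \<in> smooth_subalgebra A U V"
proof -
  obtain a b where a: "rapidly_decreasing a" "fourier_series a x"
    and b: "rapidly_decreasing b" "fourier_series b y"
    using assms by (auto simp: smooth_subalgebra_iff)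
  have "\<exists>\<kappa>. \<forall>z. cmod (\<kappa> z) = 1 \<and>
      monomial (fst z) \<otimes> monomial (snd z) = \<kappa> z \<odot> monomial (fst z + snd z)"
    by (rule choice) (use monomial_mult in blast)
  then obtain \<kappa> where \<kappa>: "\<And>z. cmod (\<kappa> z) = 1"
      "\<And>p q. monomial p \<otimes> monomial q = \<kappa> (p, q) \<odot> monomial (p + q)"
    by fastforce
  have "fourier_series (twisted_convolution \<kappa> a b) (x \<otimes> y)"
    by (rule fourier_series_mult[OF a(2) _ b(2) _ \<kappa>])
      (use rapidly_decreasing_summable[OF a(1), of 0] rapidly_decreasing_summable[OF b(1), of 0]
        in simp_all)
  then show ?thesis
    unfolding smooth_subalgebra_iff
    using rapidly_decreasing_twisted_convolution[OF a(1) b(1) \<kappa>(1)] by (intro exI conjI)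
qed

end

section \<open>Derivations and conjugation by an eigenvector\<close>

text \<open>The eigenvalue is required to be purely imaginary: then \<open>x\<^sup>*\<close> has the opposite eigenvalue, and the
  two contributions of \<open>w\<close> and \<open>w\<^sup>*\<close> to the derivative of \<open>w x w\<^sup>*\<close> cancel.\<close>

definition skew_eigenvector :: "('a, 'm) cstar_scheme \<Rightarrow> ('a \<Rightarrow> 'a) \<Rightarrow> 'a \<Rightarrow> bool" where
  "skew_eigenvector A \<delta> x \<longleftrightarrow> (\<exists>t::real. \<delta> x = (\<i> * of_real t) \<odot>\<^bsub>A\<^esub> x)"

locale star_derivation_on = unital_cstar_algebra A
  for A :: "('a, 'm) cstar_scheme" (structure) +
  fixes D :: "'a set" and \<delta> :: "'a \<Rightarrow> 'a"
  assumes derivation: "star_derivation A D \<delta>"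
    and D_closed: "x \<in> D \<Longrightarrow> x \<in> carrier A"
    and D_mult: "x \<in> D \<Longrightarrow> y \<in> D \<Longrightarrow> x \<otimes> y \<in> D"
    and D_adj: "x \<in> D \<Longrightarrow> adj A x \<in> D"
begin

lemma der_D: "x \<in> D \<Longrightarrow> \<delta> x \<in> D"
  and der_mult: "x \<in> D \<Longrightarrow> y \<in> D \<Longrightarrow> \<delta> (x \<otimes> y) = \<delta> x \<otimes> y \<oplus> x \<otimes> \<delta> y"
  and der_adj: "x \<in> D \<Longrightarrow> \<delta> (adj A x) = adj A (\<delta> x)"
  and der_scalar: "x \<in> D \<Longrightarrow> \<delta> (c \<odot> x) = c \<odot> \<delta> x"
  using derivation by (auto simp: star_derivation_def)

lemma skew_eigenvector_mult:
  assumes "x \<in> D" "y \<in> D" "skew_eigenvector A \<delta> x" "skew_eigenvector A \<delta> y"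
  shows "skew_eigenvector A \<delta> (x \<otimes> y)"
proof -
  obtain s t where "\<delta> x = (\<i> * of_real s) \<odot> x" "\<delta> y = (\<i> * of_real t) \<odot> y"
    using assms by (auto simp: skew_eigenvector_def)
  then have "\<delta> (x \<otimes> y) = (\<i> * of_real (s + t)) \<odot> (x \<otimes> y)"
    using assms(1,2) by (simp add: der_mult scalar_simps D_closed distrib_left scalar_add)
  then show ?thesis unfolding skew_eigenvector_def by blast
qed

lemma skew_eigenvector_adj:
  assumes "x \<in> D" "skew_eigenvector A \<delta> x"
  shows "skew_eigenvector A \<delta> (adj A x)"
proof -
  obtain t where "\<delta> x = (\<i> * of_real t) \<odot> x"
    using assms by (auto simp: skew_eigenvector_def)
  then have "\<delta> (adj A x) = (\<i> * of_real (- t)) \<odot> adj A x"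
    using assms(1) by (simp add: der_adj scalar_simps D_closed)
  then show ?thesis unfolding skew_eigenvector_def by blast
qed

lemma skew_eigenvector_scalar:
  assumes "x \<in> D" "skew_eigenvector A \<delta> x"
  shows "skew_eigenvector A \<delta> (c \<odot> x)"
  using assms by (auto simp: skew_eigenvector_def der_scalar scalar_simps D_closed mult_ac)

text \<open>The eigenvalue is 0: the Leibniz rule for \<open>\<one> \<one> = \<one>\<close> forces \<open>\<delta> \<one> = \<zero>\<close>.\<close>

lemma skew_eigenvector_one:
  assumes "\<one> \<in> D"
  shows "skew_eigenvector A \<delta> \<one>"
proof -
  have "\<delta> \<one> \<oplus> \<delta> \<one> = \<delta> \<one>"
    using der_mult[OF assms assms] der_D[OF assms] D_closed by simp
  then have "\<delta> \<one> = \<zero>"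
    using der_D[OF assms] D_closed by (metis add.l_cancel_one)
  then show ?thesis
    by (intro skew_eigenvector_def[THEN iffD2] exI[of _ 0]) simp
qed

lemma skew_eigenvector_int_pow:
  fixes m :: int
  assumes "unitary A x" "x \<in> D" "\<one> \<in> D" "skew_eigenvector A \<delta> x"
  shows "x [^] m \<in> D \<and> skew_eigenvector A \<delta> (x [^] m)"
proof -
  have "unitary A (x [^] m) \<and> (x [^] m \<in> D \<and> skew_eigenvector A \<delta> (x [^] m))"
    by (rule unitary_int_pow_induct[OF assms(1)])
      (use assms in \<open>auto intro: skew_eigenvector_one skew_eigenvector_mult skew_eigenvector_adj D_mult D_adj\<close>)
  then show ?thesis by blast
qed

lemma Ad_D: "w \<in> D \<Longrightarrow> x \<in> D \<Longrightarrow> Ad A w x \<in> D"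
  by (simp add: Ad_def D_mult D_adj)

text \<open>The Leibniz rule gives three terms; those where \<open>\<delta>\<close> falls on \<open>w\<close> and on \<open>w\<^sup>*\<close> are \<open>\<plusminus> \<i> t w x w\<^sup>*\<close>
  and cancel.\<close>

lemma derivation_Ad:
  assumes w: "w \<in> D" "skew_eigenvector A \<delta> w" and x: "x \<in> D"
  shows "\<delta> (Ad A w x) = Ad A w (\<delta> x)"
proof -
  obtain t where t: "\<delta> w = (\<i> * of_real t) \<odot> w"
    using w by (auto simp: skew_eigenvector_def)
  define s where "s = \<i> * complex_of_real t"
  have [simp]: "w \<in> carrier A" "x \<in> carrier A" "\<delta> x \<in> carrier A"
    using w x der_D D_closed by auto
  have adj: "\<delta> (adj A w) = (- s) \<odot> adj A w"
    using w by (simp add: der_adj t scalar_simps s_def)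
  have cancel: "s \<odot> y \<oplus> (z \<oplus> (- s) \<odot> y) = z" if "y \<in> carrier A" "z \<in> carrier A" for y z
    using that scalar_add[of y s "- s"] by (simp add: a_ac)
  have "\<delta> (Ad A w x) = \<delta> (w \<otimes> x) \<otimes> adj A w \<oplus> (w \<otimes> x) \<otimes> \<delta> (adj A w)"
    unfolding Ad_def using w x by (simp add: der_mult D_mult D_adj)
  also have "\<dots> = s \<odot> (w \<otimes> x \<otimes> adj A w) \<oplus> (w \<otimes> \<delta> x \<otimes> adj A w \<oplus> (- s) \<odot> (w \<otimes> x \<otimes> adj A w))"
    using w x by (simp add: der_mult adj t flip: s_def)
      (simp add: scalar_simps l_distr a_assoc)
  also have "\<dots> = Ad A w (\<delta> x)"
    by (simp add: cancel Ad_def)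
  finally show ?thesis .
qed

end

context unital_cstar_algebra
begin

lemma Ad_mult:
  assumes "unitary A w" "x \<in> carrier A" "y \<in> carrier A"
  shows "Ad A w x \<otimes> Ad A w y = Ad A w (x \<otimes> y)"
  using assms by (simp add: Ad_def m_assoc unitary_cancel)

lemma Ad_adj:
  assumes "w \<in> carrier A" "x \<in> carrier A"
  shows "adj A (Ad A w x) = Ad A w (adj A x)"
  using assms by (simp add: Ad_def adj_mult m_assoc)

lemma unitary_Ad: "unitary A w \<Longrightarrow> unitary A x \<Longrightarrow> unitary A (Ad A w x)"
  by (simp add: Ad_def unitary_mult unitary_adj)

lemma Ad_add:
  assumes "w \<in> carrier A" "x \<in> carrier A" "y \<in> carrier A"
  shows "Ad A w (x \<oplus> y) = Ad A w x \<oplus> Ad A w y"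
  using assms by (simp add: Ad_def l_distr r_distr)

lemma Ad_zero: "w \<in> carrier A \<Longrightarrow> Ad A w \<zero> = \<zero>"
  by (simp add: Ad_def)

end

context star_derivation_on
begin

text \<open>Each of \<open>\<delta>\<close>, product and adjoint commutes with conjugation by \<open>w\<close>.  Closure of \<open>D\<close> under
  products and adjoints enters here: the outer \<open>\<delta>\<close> may be moved past the conjugation only because
  \<open>v\<^sup>* \<delta> v\<close> is again in \<open>D\<close>.\<close>

lemma derivation_energy_Ad:
  assumes w: "unitary A w" "w \<in> D" "skew_eigenvector A \<delta> w" and v: "v \<in> D"
  shows "\<delta> (adj A (Ad A w v) \<otimes> \<delta> (Ad A w v)) = Ad A w (\<delta> (adj A v \<otimes> \<delta> v))"
proof -
  have "adj A (Ad A w v) \<otimes> \<delta> (Ad A w v) = Ad A w (adj A v \<otimes> \<delta> v)"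
    using assms der_D by (simp add: derivation_Ad Ad_adj Ad_mult D_closed)
  then show ?thesis
    using assms by (simp add: derivation_Ad D_mult D_adj der_D)
qed

end

section \<open>Conjugation preserves harmonicity\<close>

theorem theorem3p4:
  fixes \<theta> :: real
    and A :: "'a cstar"
    and U V v w :: 'a
    and \<delta>\<^sub>1 \<delta>\<^sub>2 :: "'a \<Rightarrow> 'a"
    and m n :: int
    and c :: complex
  assumes "\<theta> \<notin> \<rat>"
    and "rotation_algebra \<theta> A U V"
    and "canonical_derivations A U V \<delta>\<^sub>1 \<delta>\<^sub>2"
    and "cmod c = 1"
    and "w = c \<odot>\<^bsub>A\<^esub> (U [^]\<^bsub>A\<^esub> m \<otimes>\<^bsub>A\<^esub> V [^]\<^bsub>A\<^esub> n)"
    and "harmonic_unitary A U V \<delta>\<^sub>1 \<delta>\<^sub>2 v"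
  shows "harmonic_unitary A U V \<delta>\<^sub>1 \<delta>\<^sub>2 (Ad A w v)"
proof -
  interpret unital_cstar_algebra A
    using assms(2) by (simp add: rotation_algebra_def)
  interpret rotation_unitaries A \<theta> U V
    by unfold_locales (use assms(2) in \<open>simp add: rotation_algebra_def\<close>)
  let ?D = "smooth_subalgebra A U V"
  interpret d1: star_derivation_on A ?D \<delta>\<^sub>1
    by unfold_locales (use assms(3) in \<open>auto simp: canonical_derivations_def
        intro: smooth_closed smooth_mult smooth_adj\<close>)
  interpret d2: star_derivation_on A ?D \<delta>\<^sub>2
    by unfold_locales (use assms(3) in \<open>auto simp: canonical_derivations_def
        intro: smooth_closed smooth_mult smooth_adj\<close>)
  have D: "\<one>\<^bsub>A\<^esub> \<in> ?D" "U \<in> ?D" "V \<in> ?D"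
  proof -
    have pow: "x [^]\<^bsub>A\<^esub> (1::int) = x" if "x \<in> carrier A" for x
      using that by (simp add: int_pow_def2)
    show "\<one>\<^bsub>A\<^esub> \<in> ?D" "U \<in> ?D" "V \<in> ?D"
      using smooth_scalar_monomial[of 1 "(0, 0)"] smooth_scalar_monomial[of 1 "(1, 0)"]
        smooth_scalar_monomial[of 1 "(0, 1)"]
      by (simp_all add: monomial_def pow unitary_U unitary_V)
  qed
  have two_pi: "2 * of_real pi * \<i> = \<i> * complex_of_real (2 * pi)"
    by simp
  have zero: "\<zero>\<^bsub>A\<^esub> = (\<i> * complex_of_real 0) \<odot>\<^bsub>A\<^esub> x" if "x \<in> carrier A" for x
    using that by simp
  have eigen: "skew_eigenvector A \<delta>\<^sub>1 U" "skew_eigenvector A \<delta>\<^sub>1 V"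
      "skew_eigenvector A \<delta>\<^sub>2 U" "skew_eigenvector A \<delta>\<^sub>2 V"
    using assms(3) two_pi zero[of U] zero[of V] unitary_closed[OF unitary_U] unitary_closed[OF unitary_V]
    unfolding canonical_derivations_def skew_eigenvector_def by metis+
  have w: "w \<in> ?D" "unitary A w"
    using smooth_scalar_monomial[of c "(m, n)"] unitary_scalar[OF unitary_monomial[of "(m, n)"] assms(4)]
    by (simp_all add: assms(5) monomial_def)
  have w_eigen: "skew_eigenvector A \<delta>\<^sub>1 w" "skew_eigenvector A \<delta>\<^sub>2 w"
    unfolding assms(5)
    by (intro d1.skew_eigenvector_scalar d1.skew_eigenvector_mult d2.skew_eigenvector_scalar
        d2.skew_eigenvector_mult smooth_mult d1.skew_eigenvector_int_pow[THEN conjunct1]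
        d1.skew_eigenvector_int_pow[THEN conjunct2] d2.skew_eigenvector_int_pow[THEN conjunct2]
        unitary_U unitary_V D eigen)+
  have v: "v \<in> ?D" "unitary A v"
    and harmonic: "\<delta>\<^sub>1 (adj A v \<otimes>\<^bsub>A\<^esub> \<delta>\<^sub>1 v) \<oplus>\<^bsub>A\<^esub> \<delta>\<^sub>2 (adj A v \<otimes>\<^bsub>A\<^esub> \<delta>\<^sub>2 v) = \<zero>\<^bsub>A\<^esub>"
    using assms(6) by (auto simp: harmonic_unitary_def)
  have "\<delta>\<^sub>1 (adj A v \<otimes>\<^bsub>A\<^esub> \<delta>\<^sub>1 v) \<in> carrier A" "\<delta>\<^sub>2 (adj A v \<otimes>\<^bsub>A\<^esub> \<delta>\<^sub>2 v) \<in> carrier A"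
    using v(1) by (auto intro!: smooth_closed d1.der_D d2.der_D smooth_mult smooth_adj)
  then have "\<delta>\<^sub>1 (adj A (Ad A w v) \<otimes>\<^bsub>A\<^esub> \<delta>\<^sub>1 (Ad A w v)) \<oplus>\<^bsub>A\<^esub>
      \<delta>\<^sub>2 (adj A (Ad A w v) \<otimes>\<^bsub>A\<^esub> \<delta>\<^sub>2 (Ad A w v)) = \<zero>\<^bsub>A\<^esub>"
    using w w_eigen v harmonic
    by (simp add: d1.derivation_energy_Ad d2.derivation_energy_Ad Ad_zero flip: Ad_add)
  then show ?thesis
    using d1.Ad_D[OF w(1) v(1)] unitary_Ad[OF w(2) v(2)] by (simp add: harmonic_unitary_def)
qed

end
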